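(* Let $P$ be a BGP, $\mathcal{C}$ a finite set of completeness statements, and $G$ an RDF graph. Then $\mathcal{C}, G \models \mathrm{Compl}(P)$ if and only if for all $\mu \in \mathrm{sat}(P, \mathcal{C}, G)$ it holds that $\widetilde{\mu P} \subseteq G$.
   Context: RDF and BGPs. $I$ (IRIs), $L$ (literals), $V$ (variables) are pairwise disjoint infinite sets. A triple is an element $(s,p,o)\in I\times I\times(I\cup L)$; an (RDF) graph is a finite set of triples. A triple pattern is like a triple, except that variables are also allowed in each position. A basic graph pattern (BGP) is a finite set of triple patterns; $\mathrm{var}(P)$ is the set of variables in $P$. A mapping $\mu$ is a partial function with finite domain $\mathrm{dom}(\mu)\subseteq V$ and values in $I\cup L$; $\mu P$ is the result of replacing each variable $v\in\mathrm{dom}(\mu)$ in $P$ by $\mu(v)$. Evaluation: $[\![P]\!]_G=\{\mu \mid \mu P\subseteq G,\ \mathrm{dom}(\mu)=\mathrm{var}(P)\}$. Freezing. For a BGP $P$, the freeze mapping $\widetilde{id}$ maps each variable $?v$ of $P$ to a fresh IRI $\tilde v$ (distinct variables to distinct IRIs, which occur nowhere else, in particular not in $P$, $G$ or $\mathcal{C}$). The prototypical graph of $P$ is $\tilde P := \widetilde{id}\,P$; $\widetilde{id}^{-1}$ replaces each $\tilde v$ by $?v$. Completeness. A completeness statement is an expression $C=\mathrm{Compl}(P_C)$ with $P_C$ a non-empty BGP. For a graph $G$, $[\![Q_C]\!]_G=\bigcup_{\mu\in[\![P_C]\!]_G}\mu P_C$ (this is the CONSTRUCT query with template and pattern both $P_C$).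 For a set $\mathcal{C}$ of completeness statements, $T_{\mathcal{C}}(G)=\bigcup_{C\in\mathcal{C}}[\![Q_C]\!]_G$. An extension pair is a pair $(G,G')$ of graphs with $G\subseteq G'$. It is valid wrt. $\mathcal{C}$, written $(G,G')\models\mathcal{C}$, if $[\![Q_C]\!]_{G'}\subseteq G$ for all $C\in\mathcal{C}$ (equivalently, $T_{\mathcal{C}}(G')\subseteq G$). $(G,G')\models\mathrm{Compl}(P)$ means $[\![P]\!]_{G'}=[\![P]\!]_G$. $\mathcal{C},G\models\mathrm{Compl}(P)$ means that $(G,G')\models\mathrm{Compl}(P)$ for every extension pair $(G,G')$ (with this fixed $G$) such that $(G,G')\models\mathcal{C}$. Partial grounding. A partially mapped BGP is a pair $(P,\nu)$ of a BGP $P$ and a mapping $\nu$ with $\mathrm{dom}(\nu)\cap\mathrm{var}(P)=\emptyset$. The crucial part of $P$ wrt. $\mathcal{C}$ and $G$ is $\mathrm{cruc}_{\mathcal{C},G}(P)=P\cap\widetilde{id}^{-1}(T_{\mathcal{C}}(\tilde P\cup G))$. Equivalent partial grounding: $\mathrm{epg}((P,\nu),\mathcal{C},G)=\{(\mu P,\nu\cup\mu)\mid \mu\in[\![\mathrm{cruc}_{\mathcal{C},G}(P)]\!]_G\}$. The set of mappings $\mathrm{sat}(P,\mathcal{C},G)$ is the output $\Omega$ of the following (terminating) algorithm. Initialize $\mathbf{W}:=\{(P,\emptyset)\}$ and $\Omega:=\emptyset$. While $\mathbf{W}\neq\emptyset$: take and remove some $(P',\nu)$ from $\mathbf{W}$;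 compute $\mathbf{E}:=\mathrm{epg}((P',\nu),\mathcal{C},G)$; if $\mathbf{E}=\{(P',\nu)\}$ then set $\Omega:=\Omega\cup\{\nu\}$, otherwise set $\mathbf{W}:=\mathbf{W}\cup\mathbf{E}$. Return $\Omega$.
   Formalization: In the equivalent partial grounding, (μP, ν∪μ) is kept only if μP is a BGP (no literal in subject or predicate position); without this, P={(a,p,?x),(?x,p,b)}, G={(a,p,l)} with l a literal, C={Compl({(a,p,?x)})} is a counterexample. *)

theory Defs
  imports Main "HOL-Library.Infinite_Typeclass"
begin

datatype ('i, 'l, 'v) rdf_term = IRI 'i | Lit 'l | Var 'v

type_synonym ('i, 'l, 'v) rdf_triple =
  "('i, 'l, 'v) rdf_term \<times> ('i, 'l, 'v) rdf_term \<times> ('i, 'l, 'v) rdf_term"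

type_synonym ('i, 'l, 'v) mapping = "'v \<rightharpoonup> ('i, 'l, 'v) rdf_term"

text \<open>
  As in the usual set-theoretic presentation, triples are particular triple patterns. The
  restrictions on positions (e.g. no literals as subjects) are predicates, because applying a
  mapping to a triple pattern can violate them.
\<close>

fun triple :: "('i, 'l, 'v) rdf_triple \<Rightarrow> bool" where
  "triple (s, p, ob) \<longleftrightarrow>
     s \<in> range IRI \<and> p \<in> range IRI \<and> ob \<in> range IRI \<union> range Lit"

fun triple_pattern :: "('i, 'l, 'v) rdf_triple \<Rightarrow> bool" where
  "triple_pattern (s, p, ob) \<longleftrightarrow>
     s \<in> range IRI \<union> range Var \<and> p \<in> range IRI \<union> range Var \<and>
     ob \<in> range IRI \<union> range Lit \<union> range Var"

definition graph :: "('i, 'l, 'v) rdf_triple set \<Rightarrow> bool" where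
  "graph G \<longleftrightarrow> finite G \<and> (\<forall>t\<in>G. triple t)"

definition bgp :: "('i, 'l, 'v) rdf_triple set \<Rightarrow> bool" where
  "bgp P \<longleftrightarrow> finite P \<and> (\<forall>t\<in>P. triple_pattern t)"

definition terms_of :: "('i, 'l, 'v) rdf_triple set \<Rightarrow> ('i, 'l, 'v) rdf_term set" where
  "terms_of P = (\<Union>(s, p, ob)\<in>P. {s, p, ob})"

definition vars :: "('i, 'l, 'v) rdf_triple set \<Rightarrow> 'v set" where
  "vars P = {v. Var v \<in> terms_of P}"

definition iris :: "('i, 'l, 'v) rdf_triple set \<Rightarrow> 'i set" where
  "iris P = {i. IRI i \<in> terms_of P}"

definition mapping :: "('i, 'l, 'v) mapping \<Rightarrow> bool" where
  "mapping \<mu> \<longleftrightarrow> finite (dom \<mu>) \<and> ran \<mu> \<subseteq> range IRI \<union> range Lit"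

fun apply_term :: "('i, 'l, 'v) mapping \<Rightarrow> ('i, 'l, 'v) rdf_term \<Rightarrow> ('i, 'l, 'v) rdf_term" where
  "apply_term \<mu> (IRI i) = IRI i"
| "apply_term \<mu> (Lit l) = Lit l"
| "apply_term \<mu> (Var v) = (case \<mu> v of None \<Rightarrow> Var v | Some t \<Rightarrow> t)"

definition map_terms ::
    "(('i, 'l, 'v) rdf_term \<Rightarrow> ('i, 'l, 'v) rdf_term) \<Rightarrow>
     ('i, 'l, 'v) rdf_triple set \<Rightarrow> ('i, 'l, 'v) rdf_triple set" where
  "map_terms f P = (\<lambda>(s, p, ob). (f s, f p, f ob)) ` P"

definition apply_bgp ::
    "('i, 'l, 'v) mapping \<Rightarrow> ('i, 'l, 'v) rdf_triple set \<Rightarrow> ('i, 'l, 'v) rdf_triple set" where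
  "apply_bgp \<mu> P = map_terms (apply_term \<mu>) P"

definition eval_bgp ::
    "('i, 'l, 'v) rdf_triple set \<Rightarrow> ('i, 'l, 'v) rdf_triple set \<Rightarrow> ('i, 'l, 'v) mapping set" where
  "eval_bgp P G = {\<mu>. mapping \<mu> \<and> apply_bgp \<mu> P \<subseteq> G \<and> dom \<mu> = vars P}"

datatype ('i, 'l, 'v) compl_stmt = Compl (pattern_of: "('i, 'l, 'v) rdf_triple set")

definition completeness_statement :: "('i, 'l, 'v) compl_stmt \<Rightarrow> bool" where
  "completeness_statement C \<longleftrightarrow> bgp (pattern_of C) \<and> pattern_of C \<noteq> {}"

definition construct ::
    "('i, 'l, 'v) compl_stmt \<Rightarrow> ('i, 'l, 'v) rdf_triple set \<Rightarrow> ('i, 'l, 'v) rdf_triple set" where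
  "construct C G = (\<Union>\<mu>\<in>eval_bgp (pattern_of C) G. apply_bgp \<mu> (pattern_of C))"

definition transfer ::
    "('i, 'l, 'v) compl_stmt set \<Rightarrow> ('i, 'l, 'v) rdf_triple set \<Rightarrow> ('i, 'l, 'v) rdf_triple set" where
  "transfer \<C> G = (\<Union>C\<in>\<C>. construct C G)"

definition extension_pair ::
    "('i, 'l, 'v) rdf_triple set \<Rightarrow> ('i, 'l, 'v) rdf_triple set \<Rightarrow> bool" where
  "extension_pair G G' \<longleftrightarrow> graph G \<and> graph G' \<and> G \<subseteq> G'"

definition valid_wrt ::
    "('i, 'l, 'v) rdf_triple set \<Rightarrow> ('i, 'l, 'v) rdf_triple set \<Rightarrow>
     ('i, 'l, 'v) compl_stmt set \<Rightarrow> bool" where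
  "valid_wrt G G' \<C> \<longleftrightarrow> (\<forall>C\<in>\<C>. construct C G' \<subseteq> G)"

definition satisfies_compl ::
    "('i, 'l, 'v) rdf_triple set \<Rightarrow> ('i, 'l, 'v) rdf_triple set \<Rightarrow>
     ('i, 'l, 'v) compl_stmt \<Rightarrow> bool" where
  "satisfies_compl G G' C \<longleftrightarrow> eval_bgp (pattern_of C) G' = eval_bgp (pattern_of C) G"

definition entails_compl ::
    "('i, 'l, 'v) compl_stmt set \<Rightarrow> ('i, 'l, 'v) rdf_triple set \<Rightarrow>
     ('i, 'l, 'v) compl_stmt \<Rightarrow> bool" where
  "entails_compl \<C> G C \<longleftrightarrow>
     (\<forall>G'. extension_pair G G' \<and> valid_wrt G G' \<C> \<longrightarrow> satisfies_compl G G' C)"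

text \<open>
  The choice of the fresh IRI for a variable is a parameter \<open>fr\<close>. One choice made for a BGP
  also serves all its instantiations by mappings with values from \<open>G\<close>: these have no further
  variables, and all their IRIs come from the BGP or from \<open>G\<close>.
\<close>

definition fresh_for ::
    "('v \<Rightarrow> 'i) \<Rightarrow> ('i, 'l, 'v) rdf_triple set \<Rightarrow> ('i, 'l, 'v) compl_stmt set \<Rightarrow>
     ('i, 'l, 'v) rdf_triple set \<Rightarrow> bool" where
  "fresh_for fr P \<C> G \<longleftrightarrow>
     inj_on fr (vars P) \<and>
     fr ` vars P \<inter> (iris P \<union> iris G \<union> (\<Union>C\<in>\<C>. iris (pattern_of C))) = {}"

definition freeze :: "('v \<Rightarrow> 'i) \<Rightarrow> ('i, 'l, 'v) rdf_triple set \<Rightarrow> ('i, 'l, 'v) mapping" where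
  "freeze fr P = (\<lambda>v. if v \<in> vars P then Some (IRI (fr v)) else None)"

definition prototypical ::
    "('v \<Rightarrow> 'i) \<Rightarrow> ('i, 'l, 'v) rdf_triple set \<Rightarrow> ('i, 'l, 'v) rdf_triple set" where
  "prototypical fr P = apply_bgp (freeze fr P) P"

fun unfreeze_term ::
    "('v \<Rightarrow> 'i) \<Rightarrow> 'v set \<Rightarrow> ('i, 'l, 'v) rdf_term \<Rightarrow> ('i, 'l, 'v) rdf_term" where
  "unfreeze_term fr X (IRI i) = (if i \<in> fr ` X then Var (the_inv_into X fr i) else IRI i)"
| "unfreeze_term fr X (Lit l) = Lit l"
| "unfreeze_term fr X (Var v) = Var v"

definition crucial ::
    "('v \<Rightarrow> 'i) \<Rightarrow> ('i, 'l, 'v) compl_stmt set \<Rightarrow> ('i, 'l, 'v) rdf_triple set \<Rightarrow>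
     ('i, 'l, 'v) rdf_triple set \<Rightarrow> ('i, 'l, 'v) rdf_triple set" where
  "crucial fr \<C> G P =
     P \<inter> map_terms (unfreeze_term fr (vars P)) (transfer \<C> (prototypical fr P \<union> G))"

type_synonym ('i, 'l, 'v) pm_bgp = "('i, 'l, 'v) rdf_triple set \<times> ('i, 'l, 'v) mapping"

fun partially_mapped_bgp :: "('i, 'l, 'v) pm_bgp \<Rightarrow> bool" where
  "partially_mapped_bgp (P, \<nu>) \<longleftrightarrow> bgp P \<and> mapping \<nu> \<and> dom \<nu> \<inter> vars P = {}"

text \<open>
  The elements of an equivalent partial grounding are partially mapped BGPs. The explicit
  condition below discards exactly the mappings that put a literal into subject or predicate
  position, so that \<open>apply_bgp \<mu> P\<close> is not a BGP; no graph contains an instance of such a set.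
  Without it, completeness checking by saturation would be incorrect: take
  \<open>P = {(a, p, ?x), (?x, p, b)}\<close>, \<open>G = {(a, p, l)}\<close> with a literal \<open>l\<close>, and the only
  statement \<open>Compl {(a, p, ?x)}\<close>. Then \<open>P\<close> has no answers over any valid extension of \<open>G\<close>,
  but the ill-formed \<open>{(a, p, l), (l, p, b)}\<close> would be saturated and not contained in \<open>G\<close>.
\<close>

fun epg ::
    "('v \<Rightarrow> 'i) \<Rightarrow> ('i, 'l, 'v) pm_bgp \<Rightarrow> ('i, 'l, 'v) compl_stmt set \<Rightarrow>
     ('i, 'l, 'v) rdf_triple set \<Rightarrow> ('i, 'l, 'v) pm_bgp set" where
  "epg fr (P, \<nu>) \<C> G =
     {(apply_bgp \<mu> P, \<nu> ++ \<mu>) | \<mu>.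
        \<mu> \<in> eval_bgp (crucial fr \<C> G P) G \<and> partially_mapped_bgp (apply_bgp \<mu> P, \<nu> ++ \<mu>)}"

text \<open>One iteration of the loop on states \<open>(W, \<Omega>)\<close>; the choice of the processed element is free.\<close>

inductive sat_step ::
    "('v \<Rightarrow> 'i) \<Rightarrow> ('i, 'l, 'v) compl_stmt set \<Rightarrow> ('i, 'l, 'v) rdf_triple set \<Rightarrow>
     ('i, 'l, 'v) pm_bgp set \<times> ('i, 'l, 'v) mapping set \<Rightarrow>
     ('i, 'l, 'v) pm_bgp set \<times> ('i, 'l, 'v) mapping set \<Rightarrow> bool"
  for fr \<C> G where
  saturated:
    "(P, \<nu>) \<in> W \<Longrightarrow> epg fr (P, \<nu>) \<C> G = {(P, \<nu>)} \<Longrightarrow>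
     sat_step fr \<C> G (W, \<Omega>) (W - {(P, \<nu>)}, \<Omega> \<union> {\<nu>})"
| unsaturated:
    "(P, \<nu>) \<in> W \<Longrightarrow> epg fr (P, \<nu>) \<C> G \<noteq> {(P, \<nu>)} \<Longrightarrow>
     sat_step fr \<C> G (W, \<Omega>) (W - {(P, \<nu>)} \<union> epg fr (P, \<nu>) \<C> G, \<Omega>)"

definition sat ::
    "('v \<Rightarrow> 'i) \<Rightarrow> ('i, 'l, 'v) rdf_triple set \<Rightarrow> ('i, 'l, 'v) compl_stmt set \<Rightarrow>
     ('i, 'l, 'v) rdf_triple set \<Rightarrow> ('i, 'l, 'v) mapping set" where
  "sat fr P \<C> G = (THE \<Omega>. (sat_step fr \<C> G)\<^sup>*\<^sup>* ({(P, Map.empty)}, {}) ({}, \<Omega>))"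

lemma finite_terms_of: "finite P \<Longrightarrow> finite (terms_of P)"
  unfolding terms_of_def by auto

lemma finite_vars: "finite P \<Longrightarrow> finite (vars P)"
  unfolding vars_def
  using finite_vimageI[OF finite_terms_of, of P Var] by (simp add: inj_def vimage_def)

lemma finite_iris: "finite P \<Longrightarrow> finite (iris P)"
  unfolding iris_def
  using finite_vimageI[OF finite_terms_of, of P IRI] by (simp add: inj_def vimage_def)

lemma ex_fresh_for:
  fixes P G :: "('i::infinite, 'l, 'v) rdf_triple set"
  assumes "bgp P" "graph G" "finite \<C>" "\<forall>C\<in>\<C>. completeness_statement C"
  shows "\<exists>fr. fresh_for fr P \<C> G"
proof -
  let ?X = "iris P \<union> iris G \<union> (\<Union>C\<in>\<C>. iris (pattern_of C))"
  have "finite ?X"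
    using assms by (auto simp: bgp_def graph_def completeness_statement_def intro: finite_iris)
  then have "infinite (- ?X)"
    using infinite_UNIV by (metis Compl_eq_Diff_UNIV Diff_infinite_finite)
  then obtain B where B: "B \<subseteq> - ?X" "finite B" "card B = card (vars P)"
    using infinite_arbitrarily_large by metis
  have "finite (vars P)"
    using assms(1) by (simp add: bgp_def finite_vars)
  then obtain fr where "bij_betw fr (vars P) B"
    using B finite_same_card_bij by metis
  then show ?thesis
    using B(1) unfolding fresh_for_def bij_betw_def by blast
qed

end

theory Submission
  imports Defs
begin

text \<open>
  Every answer of \<open>P\<close> over a valid extension of \<open>G\<close> sends the crucial part of \<open>P\<close> into \<open>G\<close>:
  composing a homomorphism witnessing that a frozen triple is transferred with unfreezing and with
  the answer gives a homomorphism of the completeness pattern into the extension. Hence every answer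
  survives in some branch of the saturation, so if all saturated instances are contained in \<open>G\<close>,
  there are no answers beyond those over \<open>G\<close>. Conversely, if \<open>Q\<close> is saturated, then its crucial part
  lies in \<open>G\<close>, which says precisely that adding the frozen \<open>Q\<close> to \<open>G\<close> is a valid extension; freezing
  is an answer over it, and completeness forces the frozen \<open>Q\<close> into \<open>G\<close>.
\<close>

section \<open>Mappings and patterns\<close>

lemma map_terms_comp: "map_terms f (map_terms g P) = map_terms (f \<circ> g) P"
  unfolding map_terms_def image_image by (rule image_cong) auto

lemma map_terms_cong: "(\<And>x. x \<in> terms_of P \<Longrightarrow> f x = g x) \<Longrightarrow> map_terms f P = map_terms g P"
  unfolding map_terms_def terms_of_def by (rule image_cong) fastforce+

lemma map_terms_ident: "(\<And>x. x \<in> terms_of P \<Longrightarrow> f x = x) \<Longrightarrow> map_terms f P = P"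
  using map_terms_cong[of P f id] by (simp add: map_terms_def)

lemma map_terms_mono: "P \<subseteq> Q \<Longrightarrow> map_terms f P \<subseteq> map_terms f Q"
  unfolding map_terms_def by (rule image_mono)

lemma map_terms_Un: "map_terms f (P \<union> Q) = map_terms f P \<union> map_terms f Q"
  unfolding map_terms_def by (rule image_Un)

lemma terms_of_map_terms: "terms_of (map_terms f P) = f ` terms_of P"
  unfolding terms_of_def map_terms_def by force

lemma terms_of_mono: "P \<subseteq> Q \<Longrightarrow> terms_of P \<subseteq> terms_of Q"
  unfolding terms_of_def by auto

lemma vars_mono: "P \<subseteq> Q \<Longrightarrow> vars P \<subseteq> vars Q"
  unfolding vars_def using terms_of_mono by auto

lemma vars_graph:
  assumes "graph G"
  shows "vars G = {}"
  using assms by (fastforce simp: graph_def vars_def terms_of_def)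

lemma apply_bgp_disjoint:
  assumes "dom \<mu> \<inter> vars P = {}"
  shows "apply_bgp \<mu> P = P"
  unfolding apply_bgp_def
proof (rule map_terms_ident)
  fix x assume "x \<in> terms_of P"
  then show "apply_term \<mu> x = x"
    using assms by (cases x) (auto simp: vars_def split: option.split)
qed

lemma mapping_ground:
  assumes "mapping \<mu>" "\<mu> v = Some x"
  shows "x \<in> range IRI \<union> range Lit"
  using assms unfolding mapping_def ran_def by blast

text \<open>Values of \<open>\<nu>\<close> are ground, so \<open>\<mu>\<close> leaves them alone.
  Disjoint domains reconcile the two priorities: \<open>++\<close> prefers \<open>\<mu>\<close>,
  while in the successive application \<open>\<nu>\<close> acts first.\<close>

lemma apply_bgp_map_add:
  assumes "mapping \<nu>" "dom \<nu> \<inter> dom \<mu> = {}"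
  shows "apply_bgp (\<nu> ++ \<mu>) P = apply_bgp \<mu> (apply_bgp \<nu> P)"
  unfolding apply_bgp_def map_terms_comp
proof (rule map_terms_cong)
  fix x
  show "apply_term (\<nu> ++ \<mu>) x = (apply_term \<mu> \<circ> apply_term \<nu>) x"
    using assms(2)
    by (cases x) (auto simp: map_add_def split: option.split dest: mapping_ground[OF assms(1)])
qed

lemma vars_apply_bgp:
  assumes "mapping \<mu>"
  shows "vars (apply_bgp \<mu> P) = vars P - dom \<mu>"
proof -
  have "Var v = apply_term \<mu> x \<longleftrightarrow> x = Var v \<and> v \<notin> dom \<mu>" for x v
    by (cases x) (auto split: option.split dest: mapping_ground[OF assms])
  then show ?thesis
    unfolding vars_def apply_bgp_def terms_of_map_terms by (auto simp: image_iff)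
qed

lemma mapping_map_add: "mapping \<nu> \<Longrightarrow> mapping \<mu> \<Longrightarrow> mapping (\<nu> ++ \<mu>)"
  unfolding mapping_def ran_def by (auto simp: map_add_Some_iff)

lemma mapping_restrict: "mapping \<mu> \<Longrightarrow> mapping (\<mu> |` A)"
proof -
  have "ran (\<mu> |` A) \<subseteq> ran \<mu>"
    by (auto dest!: ran_restrictD intro: ranI)
  then show "mapping \<mu> \<Longrightarrow> mapping (\<mu> |` A)"
    by (auto simp: mapping_def)
qed

text \<open>A mapping fixes literals, so a literal in subject or predicate position would survive
  into the graph. This discharges the well-formedness condition in \<open>epg\<close>.\<close>

lemma bgp_if_apply_bgp_graph:
  assumes "graph (apply_bgp \<mu> P)" "finite P"
  shows "bgp P"
  unfolding bgp_def
proof (intro conjI ballI)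
  fix t assume "t \<in> P"
  obtain s p ob where t: "t = (s, p, ob)" by (cases t)
  have pos: "x \<in> range IRI \<or> x \<in> range Var" if "apply_term \<mu> x \<in> range IRI" for x
    using that by (cases x) auto
  have "triple (apply_term \<mu> s, apply_term \<mu> p, apply_term \<mu> ob)"
    using assms \<open>t \<in> P\<close> t unfolding graph_def apply_bgp_def map_terms_def by force
  then show "triple_pattern t"
    unfolding t using pos by (cases ob) auto
qed fact

section \<open>Answers of a pattern over a graph\<close>

lemma eval_bgp_mono: "G \<subseteq> G' \<Longrightarrow> eval_bgp P G \<subseteq> eval_bgp P G'"
  unfolding eval_bgp_def by auto

text \<open>Every variable in the domain occurs in the pattern, so its value occurs in the matched
  part of the graph. This bound serves both finiteness of the evaluation and preservation of
  freshness.\<close>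

lemma eval_bgp_ran:
  assumes "\<mu> \<in> eval_bgp P G"
  shows "ran \<mu> \<subseteq> terms_of G"
proof
  fix x assume "x \<in> ran \<mu>"
  then obtain v where v: "\<mu> v = Some x"
    by (auto simp: ran_def)
  then have "Var v \<in> terms_of P"
    using assms by (auto simp: eval_bgp_def vars_def)
  then have "apply_term \<mu> (Var v) \<in> terms_of (apply_bgp \<mu> P)"
    unfolding apply_bgp_def terms_of_map_terms by (rule imageI)
  then show "x \<in> terms_of G"
    using v assms terms_of_mono[of "apply_bgp \<mu> P" G] by (auto simp: eval_bgp_def)
qed

lemma finite_eval_bgp:
  assumes "finite P" "finite G"
  shows "finite (eval_bgp P G)"
proof (rule finite_subset)
  show "eval_bgp P G \<subseteq> {\<mu>. dom \<mu> = vars P \<and> ran \<mu> \<subseteq> terms_of G}"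
    using eval_bgp_ran by (auto simp: eval_bgp_def)
  show "finite {\<mu>. dom \<mu> = vars P \<and> ran \<mu> \<subseteq> terms_of G}"
    using assms by (intro finite_set_of_finite_maps finite_vars finite_terms_of)
qed

text \<open>Separates an answer into one grounding step \<open>\<mu>\<close> and the answer
  \<open>\<rho>\<close> that remains; applied with \<open>R\<close> the crucial part of
  \<open>Q\<close>.\<close>

lemma eval_bgp_split:
  assumes \<tau>: "\<tau> \<in> eval_bgp Q G'" and "R \<subseteq> Q"
  defines "\<mu> \<equiv> \<tau> |` vars R" and "\<rho> \<equiv> \<tau> |` (- vars R)"
  shows "apply_bgp \<mu> R = apply_bgp \<tau> R"
    and "mapping \<mu>" and "dom \<mu> = vars R"
    and "\<mu> ++ \<rho> = \<tau>"
    and "\<rho> \<in> eval_bgp (apply_bgp \<mu> Q) G'"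
proof -
  have m: "mapping \<tau>" "dom \<tau> = vars Q" "apply_bgp \<tau> Q \<subseteq> G'"
    using \<tau> by (auto simp: eval_bgp_def)
  show split: "\<mu> ++ \<rho> = \<tau>"
    by (rule ext) (auto simp: \<mu>_def \<rho>_def map_add_def restrict_map_def split: option.split)
  show \<mu>: "mapping \<mu>"
    unfolding \<mu>_def by (rule mapping_restrict) fact
  show dom: "dom \<mu> = vars R"
    using m(2) vars_mono[OF \<open>R \<subseteq> Q\<close>] by (auto simp: \<mu>_def)
  have disj: "dom \<mu> \<inter> dom \<rho> = {}"
    by (auto simp: \<mu>_def \<rho>_def)
  note compose = apply_bgp_map_add[OF \<mu> disj, unfolded split]
  show "apply_bgp \<mu> R = apply_bgp \<tau> R"
    using vars_apply_bgp[OF \<mu>, of R] by (simp add: compose apply_bgp_disjoint dom)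
  show "\<rho> \<in> eval_bgp (apply_bgp \<mu> Q) G'"
    using m compose[of Q] vars_apply_bgp[OF \<mu>, of Q] dom mapping_restrict[OF m(1)]
    by (auto simp: eval_bgp_def \<rho>_def)
qed

section \<open>Freezing and the crucial part\<close>

text \<open>IRIs introduced by \<open>\<mu>\<close> come from \<open>G\<close>, which
  \<open>fr\<close> avoids, and instantiation creates no variables. Hence one choice of
  \<open>fr\<close> serves the entire saturation.\<close>

lemma fresh_for_apply_bgp:
  assumes "fresh_for fr P \<C> G" "mapping \<mu>" "ran \<mu> \<subseteq> terms_of G"
  shows "fresh_for fr (apply_bgp \<mu> P) \<C> G"
proof -
  have "apply_term \<mu> x = IRI i \<Longrightarrow> x = IRI i \<or> IRI i \<in> terms_of G" for x i
    using assms(3) by (cases x) (auto simp: ran_def split: option.splits)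
  then have "iris (apply_bgp \<mu> P) \<subseteq> iris P \<union> iris G"
    unfolding iris_def apply_bgp_def terms_of_map_terms by (auto simp: image_iff) metis
  then show ?thesis
    using assms(1) vars_apply_bgp[OF assms(2), of P] unfolding fresh_for_def
    by (auto simp: inj_on_def)
qed

lemma unfreeze_term_ident:
  assumes "x \<in> terms_of P" "fr ` X \<inter> iris P = {}"
  shows "unfreeze_term fr X x = x"
  using assms by (cases x) (auto simp: iris_def)

lemma dom_freeze: "dom (freeze fr P) = vars P"
  by (auto simp: freeze_def split: if_splits)

lemma mapping_freeze: "finite P \<Longrightarrow> mapping (freeze fr P)"
  by (auto simp: mapping_def dom_freeze finite_vars) (auto simp: ran_def freeze_def split: if_splits)

text \<open>Since \<open>fr\<close> avoids the IRIs of \<open>P\<close>, none of these is unfrozen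
  by accident, and injectivity recovers each variable.\<close>

lemma unfreeze_prototypical:
  assumes "fresh_for fr P \<C> G"
  shows "map_terms (unfreeze_term fr (vars P)) (prototypical fr P) = P"
  unfolding prototypical_def apply_bgp_def map_terms_comp
proof (rule map_terms_ident)
  fix x assume "x \<in> terms_of P"
  then show "(unfreeze_term fr (vars P) \<circ> apply_term (freeze fr P)) x = x"
    using assms
    by (cases x) (auto simp: freeze_def fresh_for_def vars_def iris_def the_inv_into_f_f)
qed

lemma unfreeze_graph:
  assumes "fresh_for fr P \<C> G"
  shows "map_terms (unfreeze_term fr (vars P)) G = G"
  using assms by (intro map_terms_ident unfreeze_term_ident) (auto simp: fresh_for_def)

lemma graph_prototypical:
  assumes "bgp P"
  shows "graph (prototypical fr P)"
proof -
  have frozen: "apply_term (freeze fr P) (Var v) = IRI (fr v)" if "Var v \<in> terms_of P" for v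
    using that by (simp add: freeze_def vars_def)
  have "triple (apply_term (freeze fr P) s, apply_term (freeze fr P) p, apply_term (freeze fr P) ob)"
    if "(s, p, ob) \<in> P" for s p ob
  proof -
    have "triple_pattern (s, p, ob)"
      using assms that by (auto simp: bgp_def)
    moreover have "{s, p, ob} \<subseteq> terms_of P"
      using that by (force simp: terms_of_def)
    ultimately show ?thesis
      by (auto simp: frozen simp del: apply_term.simps(3))
  qed
  then show ?thesis
    using assms unfolding graph_def prototypical_def apply_bgp_def map_terms_def bgp_def by auto
qed

lemma vars_empty_if_prototypical_subset:
  assumes "fresh_for fr P \<C> G" "prototypical fr P \<subseteq> G"
  shows "vars P = {}"
proof (rule ccontr)
  assume "vars P \<noteq> {}"
  then obtain v where v: "v \<in> vars P" by blast
  then have "apply_term (freeze fr P) (Var v) \<in> terms_of (prototypical fr P)"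
    unfolding prototypical_def apply_bgp_def terms_of_map_terms vars_def by blast
  then have "fr v \<in> iris G"
    using v terms_of_mono[OF assms(2)] by (auto simp: freeze_def iris_def)
  then show False
    using v assms(1) by (auto simp: fresh_for_def)
qed

lemma transfer_subset: "transfer \<C> G \<subseteq> G"
  by (auto simp: transfer_def construct_def eval_bgp_def)

lemma crucial_subset: "crucial fr \<C> G P \<subseteq> P"
  by (auto simp: crucial_def)

lemma answer_maps_crucial_into_graph:
  assumes fresh: "fresh_for fr Q \<C> G" and ext: "extension_pair G G'" and valid: "valid_wrt G G' \<C>"
    and \<tau>: "\<tau> \<in> eval_bgp Q G'"
  shows "apply_bgp \<tau> (crucial fr \<C> G Q) \<subseteq> G"
proof -
  let ?u = "unfreeze_term fr (vars Q)"
  have "map_terms (apply_term \<tau> \<circ> ?u) (apply_bgp \<kappa> PC) \<subseteq> G"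
    if C: "Compl PC \<in> \<C>" and \<kappa>: "\<kappa> \<in> eval_bgp PC (prototypical fr Q \<union> G)" for PC \<kappa>
  proof -
    define \<sigma> where "\<sigma> = map_option (apply_term \<tau> \<circ> ?u) \<circ> \<kappa>"
    have "apply_term \<sigma> x = (apply_term \<tau> \<circ> ?u \<circ> apply_term \<kappa>) x" if x: "x \<in> terms_of PC" for x
    proof (cases x)
      \<comment> \<open>Freshness with respect to the completeness patterns keeps their constants
        from being unfrozen.\<close>
      case (IRI i)
      then have "i \<in> (\<Union>C\<in>\<C>. iris (pattern_of C))"
        using x C by (force simp: iris_def)
      then have "i \<notin> fr ` vars Q"
        using fresh by (auto simp: fresh_for_def)
      then show ?thesis
        using IRI by simp
    next
      case (Var v)
      then show ?thesis
        using x \<kappa> by (auto simp: \<sigma>_def eval_bgp_def vars_def split: option.split)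
    qed simp
    then have eq: "apply_bgp \<sigma> PC = map_terms (apply_term \<tau> \<circ> ?u) (apply_bgp \<kappa> PC)"
      unfolding apply_bgp_def map_terms_comp by (rule map_terms_cong)
    also have "\<dots> \<subseteq> map_terms (apply_term \<tau> \<circ> ?u) (prototypical fr Q \<union> G)"
      using \<kappa> by (intro map_terms_mono) (simp add: eval_bgp_def)
    also have "\<dots> = apply_bgp \<tau> Q \<union> apply_bgp \<tau> G"
      unfolding map_terms_comp[symmetric] map_terms_Un unfreeze_prototypical[OF fresh]
        unfreeze_graph[OF fresh] apply_bgp_def ..
    also have "apply_bgp \<tau> G = G"
      using ext by (intro apply_bgp_disjoint) (simp add: extension_pair_def vars_graph)
    finally have sub: "apply_bgp \<sigma> PC \<subseteq> G'"
      using \<tau> ext by (auto simp: eval_bgp_def extension_pair_def)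
    have dom: "dom \<sigma> = vars PC"
      using \<kappa> by (auto simp: \<sigma>_def eval_bgp_def)
    have "mapping \<sigma>"
      unfolding mapping_def
    proof
      show "finite (dom \<sigma>)"
        using \<kappa> dom by (auto simp: eval_bgp_def mapping_def)
      \<comment> \<open>Groundness is not visible from the definition of \<open>\<sigma>\<close>,
        since unfreezing produces variables; it holds because every value occurs in the graph
        \<open>G'\<close>.\<close>
      show "ran \<sigma> \<subseteq> range IRI \<union> range Lit"
      proof
        fix x assume "x \<in> ran \<sigma>"
        then obtain v where v: "\<sigma> v = Some x"
          by (auto simp: ran_def)
        then have "Var v \<in> terms_of PC"
          using dom by (auto simp: vars_def)
        then have "apply_term \<sigma> (Var v) \<in> terms_of (apply_bgp \<sigma> PC)"
          unfolding apply_bgp_def terms_of_map_terms by (rule imageI)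
        then have "x \<in> terms_of G'"
          using v terms_of_mono[OF sub] by auto
        then show "x \<in> range IRI \<union> range Lit"
          using ext vars_graph[of G'] by (cases x) (auto simp: extension_pair_def vars_def)
      qed
    qed
    then have "\<sigma> \<in> eval_bgp PC G'"
      using sub dom by (simp add: eval_bgp_def)
    then have "apply_bgp \<sigma> PC \<subseteq> construct (Compl PC) G'"
      by (auto simp: construct_def)
    then show ?thesis
      using valid C eq by (auto simp: valid_wrt_def)
  qed
  \<comment> \<open>The set on the right expresses the inclusion triple by triple, so that it passes
    to unions over matches and statements.\<close>
  then have "construct C (prototypical fr Q \<union> G) \<subseteq> {t. map_terms (apply_term \<tau> \<circ> ?u) {t} \<subseteq> G}"
    if "C \<in> \<C>" for C
    using that by (cases C) (fastforce simp: construct_def map_terms_def)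
  then have "map_terms (apply_term \<tau> \<circ> ?u) (transfer \<C> (prototypical fr Q \<union> G)) \<subseteq> G"
    by (fastforce simp: transfer_def map_terms_def)
  moreover have "apply_bgp \<tau> (crucial fr \<C> G Q) \<subseteq>
      map_terms (apply_term \<tau> \<circ> ?u) (transfer \<C> (prototypical fr Q \<union> G))"
    unfolding apply_bgp_def map_terms_comp[symmetric]
    by (rule map_terms_mono) (simp add: crucial_def)
  ultimately show ?thesis
    by blast
qed

text \<open>A transferred triple outside \<open>G\<close> is a frozen triple of \<open>Q\<close>, so
  its unfreezing is crucial and lies in \<open>G\<close>. It is therefore ground, so unfreezing
  changed nothing and the triple was in \<open>G\<close> after all.\<close>

lemma frozen_extension_valid:
  assumes "graph G" and fresh: "fresh_for fr Q \<C> G" and cruc: "crucial fr \<C> G Q \<subseteq> G"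
  shows "valid_wrt G (G \<union> prototypical fr Q) \<C>"
proof -
  let ?u = "unfreeze_term fr (vars Q)"
  have "t \<in> G" if t: "t \<in> transfer \<C> (prototypical fr Q \<union> G)" for t
  proof (rule ccontr)
    assume "t \<notin> G"
    then have pt: "t \<in> prototypical fr Q"
      using t transfer_subset by blast
    have singleton: "map_terms ?u {t} \<subseteq> map_terms ?u A" if "t \<in> A" for A
      using that by (intro map_terms_mono) simp
    have "map_terms ?u {t} \<subseteq> crucial fr \<C> G Q"
      using singleton[OF t] singleton[OF pt] unfreeze_prototypical[OF fresh]
      by (simp add: crucial_def)
    then have G: "map_terms ?u {t} \<subseteq> G"
      using cruc by blast
    \<comment> \<open>Unfreezing alters an IRI only by turning it into a variable, and
      \<open>G\<close> has none.\<close>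
    have "map_terms ?u {t} = {t}"
    proof (rule map_terms_ident)
      fix x assume "x \<in> terms_of {t}"
      then have "?u x \<in> terms_of (map_terms ?u {t})"
        unfolding terms_of_map_terms by (rule imageI)
      then have "?u x \<in> terms_of G"
        using terms_of_mono[OF G] by blast
      then have "?u x \<notin> range Var"
        using vars_graph[OF assms(1)] by (auto simp: vars_def)
      then show "?u x = x"
        by (cases x) (auto split: if_splits)
    qed
    then show False
      using G \<open>t \<notin> G\<close> by simp
  qed
  then show ?thesis
    unfolding valid_wrt_def transfer_def by (auto simp: Un_commute)
qed

section \<open>Equivalent partial groundings\<close>

text \<open>A grounding that returns \<open>Q\<close> itself binds no variable, and the empty
  mapping is an answer of the crucial part only if that part is contained in
  \<open>G\<close>.\<close>

lemma epg_saturatedD: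
  assumes "epg fr (Q, \<nu>) \<C> G = {(Q, \<nu>)}"
  shows "crucial fr \<C> G Q \<subseteq> G"
proof -
  obtain \<mu> where \<mu>: "\<mu> \<in> eval_bgp (crucial fr \<C> G Q) G" "apply_bgp \<mu> Q = Q"
  proof -
    have "(Q, \<nu>) \<in> epg fr (Q, \<nu>) \<C> G"
      using assms by blast
    then show ?thesis
      using that by auto
  qed
  then have "vars Q = vars Q - dom \<mu>"
    using vars_apply_bgp[of \<mu> Q] by (simp add: eval_bgp_def)
  moreover have "dom \<mu> \<subseteq> vars Q"
    using \<mu>(1) vars_mono[OF crucial_subset[of fr \<C> G Q]] by (auto simp: eval_bgp_def)
  ultimately have "dom \<mu> = {}"
    by blast
  then show ?thesis
    using \<mu>(1) by (simp add: eval_bgp_def apply_bgp_disjoint)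
qed

text \<open>The termination measure. With a variable-free crucial part only the empty mapping could
  be used, and the one possible grounding would be the element itself; so a proper step binds at
  least one variable.\<close>

lemma epg_vars_less:
  assumes "partially_mapped_bgp (Q, \<nu>)" "epg fr (Q, \<nu>) \<C> G \<noteq> {(Q, \<nu>)}"
    and "(Q', \<nu>') \<in> epg fr (Q, \<nu>) \<C> G"
  shows "card (vars Q') < card (vars Q)"
proof -
  obtain \<mu> where \<mu>: "\<mu> \<in> eval_bgp (crucial fr \<C> G Q) G" "Q' = apply_bgp \<mu> Q"
    using assms(3) by auto
  have sub: "vars (crucial fr \<C> G Q) \<subseteq> vars Q"
    by (rule vars_mono[OF crucial_subset])
  have "vars (crucial fr \<C> G Q) \<noteq> {}"
  proof
    assume "vars (crucial fr \<C> G Q) = {}"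
    then have "epg fr (Q, \<nu>) \<C> G \<subseteq> {(Q, \<nu>)}"
      by (auto simp: eval_bgp_def apply_bgp_disjoint)
    then show False
      using assms(2,3) by blast
  qed
  then have "vars Q' \<subset> vars Q"
    using \<mu> sub vars_apply_bgp[of \<mu> Q] by (auto simp: eval_bgp_def)
  then show ?thesis
    using assms(1) by (simp add: psubset_card_mono finite_vars bgp_def)
qed

lemma finite_epg:
  assumes "bgp Q" "graph G"
  shows "finite (epg fr (Q, \<nu>) \<C> G)"
proof -
  have "finite (crucial fr \<C> G Q)"
    using assms finite_subset[OF crucial_subset] by (auto simp: bgp_def)
  then have "finite (eval_bgp (crucial fr \<C> G Q) G)"
    using assms by (intro finite_eval_bgp) (auto simp: graph_def)
  then show ?thesis
    by simp
qed

lemma epg_partially_mapped: "y \<in> epg fr x \<C> G \<Longrightarrow> partially_mapped_bgp y"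
  by (cases x) auto

text \<open>Keeps every element tied to the initial \<open>P\<close>: since \<open>\<nu>\<close>
  binds no variable of \<open>Q\<close>, the new bindings extend it without overriding
  anything.\<close>

lemma epg_invariant:
  assumes inv: "partially_mapped_bgp (Q, \<nu>)" "fresh_for fr Q \<C> G" "Q = apply_bgp \<nu> P" "dom \<nu> \<subseteq> vars P"
    and "(Q', \<nu>') \<in> epg fr (Q, \<nu>) \<C> G"
  shows "partially_mapped_bgp (Q', \<nu>')" "fresh_for fr Q' \<C> G" "Q' = apply_bgp \<nu>' P" "dom \<nu>' \<subseteq> vars P"
proof -
  obtain \<mu> where \<mu>: "\<mu> \<in> eval_bgp (crucial fr \<C> G Q) G" "Q' = apply_bgp \<mu> Q" "\<nu>' = \<nu> ++ \<mu>"
    using assms(5) by auto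
  show "partially_mapped_bgp (Q', \<nu>')"
    using assms(5) by (rule epg_partially_mapped)
  have m: "mapping \<mu>" "mapping \<nu>"
    using \<mu>(1) inv(1) by (auto simp: eval_bgp_def)
  have dom: "dom \<mu> \<subseteq> vars Q"
    using \<mu>(1) vars_mono[OF crucial_subset[of fr \<C> G Q]] by (auto simp: eval_bgp_def)
  show "fresh_for fr Q' \<C> G"
    using fresh_for_apply_bgp[OF inv(2) m(1) eval_bgp_ran[OF \<mu>(1)]] \<mu>(2) by simp
  have "dom \<nu> \<inter> dom \<mu> = {}"
    using inv(1) dom by auto
  then show "Q' = apply_bgp \<nu>' P"
    using apply_bgp_map_add[OF m(2)] \<mu> inv(3) by simp
  show "dom \<nu>' \<subseteq> vars P"
    using \<mu>(3) dom inv(3,4) vars_apply_bgp[OF m(2), of P] by auto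
qed

text \<open>The part of \<open>\<tau>\<close> on the crucial variables maps the crucial part into
  \<open>G\<close>, so it is among the groundings; the rest of \<open>\<tau>\<close> answers the
  grounded pattern.\<close>

lemma answer_in_epg:
  assumes fresh: "fresh_for fr Q \<C> G" and ext: "extension_pair G G'" and valid: "valid_wrt G G' \<C>"
    and \<tau>: "\<tau> \<in> eval_bgp Q G'" and pm: "partially_mapped_bgp (Q, \<nu>)"
  obtains Q' \<nu>' \<rho> where "(Q', \<nu>') \<in> epg fr (Q, \<nu>) \<C> G" "fresh_for fr Q' \<C> G"
    "\<rho> \<in> eval_bgp Q' G'" "\<nu>' ++ \<rho> = \<nu> ++ \<tau>"
proof -
  let ?R = "crucial fr \<C> G Q"
  define \<mu> where "\<mu> = \<tau> |` vars ?R"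
  define \<rho> where "\<rho> = \<tau> |` (- vars ?R)"
  note split = eval_bgp_split[OF \<tau> crucial_subset[of fr \<C> G Q], folded \<mu>_def \<rho>_def]
  have \<mu>: "\<mu> \<in> eval_bgp ?R G"
    using split(1-3) answer_maps_crucial_into_graph[OF fresh ext valid \<tau>]
    by (simp add: eval_bgp_def)
  have "apply_bgp \<rho> (apply_bgp \<mu> Q) \<subseteq> G'" "graph G'"
    using split(5) ext by (auto simp: eval_bgp_def extension_pair_def)
  \<comment> \<open>The remaining answer certifies that the grounding has put no literal into a
    forbidden position.\<close>
  then have "graph (apply_bgp \<rho> (apply_bgp \<mu> Q))"
    by (auto simp: graph_def intro: finite_subset)
  then have "bgp (apply_bgp \<mu> Q)"
    using pm by (intro bgp_if_apply_bgp_graph) (auto simp: bgp_def apply_bgp_def map_terms_def)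
  moreover have "dom (\<nu> ++ \<mu>) \<inter> vars (apply_bgp \<mu> Q) = {}"
    using pm vars_apply_bgp[OF split(2), of Q] by auto
  ultimately have "(apply_bgp \<mu> Q, \<nu> ++ \<mu>) \<in> epg fr (Q, \<nu>) \<C> G"
    using \<mu> pm mapping_map_add[OF _ split(2)] by auto
  moreover have "fresh_for fr (apply_bgp \<mu> Q) \<C> G"
    by (rule fresh_for_apply_bgp[OF fresh split(2) eval_bgp_ran[OF \<mu>]])
  moreover have "(\<nu> ++ \<mu>) ++ \<rho> = \<nu> ++ \<tau>"
    by (simp add: split(4) flip: map_add_assoc)
  ultimately show ?thesis
    using split(5) that by blast
qed

section \<open>Outcomes of the saturation algorithm\<close>

text \<open>A single branch of the computation, ending in the leaf mapping. Having no work list, it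
  describes the outcome independently of the order of processing.\<close>

inductive saturates_to ::
    "('v \<Rightarrow> 'i) \<Rightarrow> ('i, 'l, 'v) compl_stmt set \<Rightarrow> ('i, 'l, 'v) rdf_triple set \<Rightarrow>
     ('i, 'l, 'v) pm_bgp \<Rightarrow> ('i, 'l, 'v) mapping \<Rightarrow> bool"
  for fr \<C> G where
  saturated: "epg fr (Q, \<nu>) \<C> G = {(Q, \<nu>)} \<Longrightarrow> saturates_to fr \<C> G (Q, \<nu>) \<nu>"
| unsaturated: "epg fr (Q, \<nu>) \<C> G \<noteq> {(Q, \<nu>)} \<Longrightarrow> (Q', \<nu>') \<in> epg fr (Q, \<nu>) \<C> G \<Longrightarrow>
     saturates_to fr \<C> G (Q', \<nu>') \<omega> \<Longrightarrow> saturates_to fr \<C> G (Q, \<nu>) \<omega>"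

lemma saturates_to_saturated:
  assumes "epg fr (Q, \<nu>) \<C> G = {(Q, \<nu>)}"
  shows "saturates_to fr \<C> G (Q, \<nu>) \<omega> \<longleftrightarrow> \<omega> = \<nu>"
proof
  assume "saturates_to fr \<C> G (Q, \<nu>) \<omega>"
  then show "\<omega> = \<nu>"
    using assms by cases blast+
qed (use saturates_to.saturated[OF assms] in blast)

lemma saturates_to_unsaturated:
  assumes "epg fr (Q, \<nu>) \<C> G \<noteq> {(Q, \<nu>)}"
  shows "saturates_to fr \<C> G (Q, \<nu>) \<omega> \<longleftrightarrow> (\<exists>y\<in>epg fr (Q, \<nu>) \<C> G. saturates_to fr \<C> G y \<omega>)"
proof
  assume "saturates_to fr \<C> G (Q, \<nu>) \<omega>"
  then show "\<exists>y\<in>epg fr (Q, \<nu>) \<C> G. saturates_to fr \<C> G y \<omega>"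
    using assms by cases blast+
next
  assume "\<exists>y\<in>epg fr (Q, \<nu>) \<C> G. saturates_to fr \<C> G y \<omega>"
  then obtain Q' \<nu>' where "(Q', \<nu>') \<in> epg fr (Q, \<nu>) \<C> G" "saturates_to fr \<C> G (Q', \<nu>') \<omega>"
    by (metis surj_pair)
  then show "saturates_to fr \<C> G (Q, \<nu>) \<omega>"
    by (rule saturates_to.unsaturated[OF assms])
qed

section \<open>Loop invariant, termination and the value of \<open>sat\<close>\<close>

lemma sat_step_invariant:
  assumes "sat_step fr \<C> G (W, \<Omega>) (W', \<Omega>')"
  shows "\<Omega> \<union> {\<omega>. \<exists>w\<in>W. saturates_to fr \<C> G w \<omega>} = \<Omega>' \<union> {\<omega>. \<exists>w\<in>W'. saturates_to fr \<C> G w \<omega>}"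
  using assms
proof cases
  case (saturated Q \<nu>)
  have "W = insert (Q, \<nu>) (W - {(Q, \<nu>)})"
    using saturated(3) by blast
  then have "{\<omega>. \<exists>w\<in>W. saturates_to fr \<C> G w \<omega>} =
      {\<nu>} \<union> {\<omega>. \<exists>w\<in>W - {(Q, \<nu>)}. saturates_to fr \<C> G w \<omega>}"
    using saturates_to_saturated[OF saturated(4)] by blast
  then show ?thesis
    unfolding saturated(1,2) by blast
next
  case (unsaturated Q \<nu>)
  have "W = insert (Q, \<nu>) (W - {(Q, \<nu>)})"
    using unsaturated(3) by blast
  then have "{\<omega>. \<exists>w\<in>W. saturates_to fr \<C> G w \<omega>} =
      {\<omega>. \<exists>w\<in>W - {(Q, \<nu>)} \<union> epg fr (Q, \<nu>) \<C> G. saturates_to fr \<C> G w \<omega>}"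
    using saturates_to_unsaturated[OF unsaturated(4)] by blast
  then show ?thesis
    unfolding unsaturated(1,2) by blast
qed

text \<open>Once the work list is empty, the invariant determines the collected set, which gives the
  uniqueness needed by the definite description in \<open>sat\<close>.\<close>

lemma sat_run_invariant:
  assumes "(sat_step fr \<C> G)\<^sup>*\<^sup>* (W, \<Omega>) (W', \<Omega>')"
  shows "\<Omega> \<union> {\<omega>. \<exists>w\<in>W. saturates_to fr \<C> G w \<omega>} = \<Omega>' \<union> {\<omega>. \<exists>w\<in>W'. saturates_to fr \<C> G w \<omega>}"
  using assms
  by (induction rule: rtranclp_induct2) (rule refl, erule trans, rule sat_step_invariant)

text \<open>
  Always processing an element with the maximal number \<open>n\<close> of variables exhausts the elements of
  that rank, since their groundings have fewer variables.
\<close>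

lemma sat_run_exists:
  assumes "graph G" "finite W" "\<forall>w\<in>W. partially_mapped_bgp w \<and> card (vars (fst w)) < n"
  shows "\<exists>\<Omega>'. (sat_step fr \<C> G)\<^sup>*\<^sup>* (W, \<Omega>) ({}, \<Omega>')"
  using assms(2,3)
proof (induction n arbitrary: W \<Omega>)
  case 0
  then have "W = {}" by auto
  then show ?case by blast
next
  case (Suc n W \<Omega>)
  from Suc.prems show ?case
  \<comment> \<open>Inner induction on the number of pending elements of the top rank
    \<open>n\<close>; when none is left, the outer hypothesis applies.\<close>
  proof (induction "card {w \<in> W. card (vars (fst w)) = n}" arbitrary: W \<Omega> rule: less_induct)
    case (less W \<Omega>)
    show ?case
    proof (cases "\<exists>w\<in>W. card (vars (fst w)) = n")
      case False
      then have "\<forall>w\<in>W. partially_mapped_bgp w \<and> card (vars (fst w)) < n"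
        using less.prems(2) less_Suc_eq by auto
      then show ?thesis
        using Suc.IH less.prems(1) by blast
    next
      case True
      then obtain Q \<nu> where w: "(Q, \<nu>) \<in> W" "card (vars Q) = n"
        by auto
      have pm: "partially_mapped_bgp (Q, \<nu>)"
        using less.prems(2) w(1) by blast
      obtain W' \<Omega>1 where step: "sat_step fr \<C> G (W, \<Omega>) (W', \<Omega>1)" and W': "finite W'"
        "\<forall>w\<in>W'. w \<in> W - {(Q, \<nu>)} \<or> partially_mapped_bgp w \<and> card (vars (fst w)) < n"
      proof (cases "epg fr (Q, \<nu>) \<C> G = {(Q, \<nu>)}")
        case True
        then show ?thesis
          using that[OF sat_step.saturated[OF w(1) True]] less.prems(1) by auto
      next
        case False
        have "finite (epg fr (Q, \<nu>) \<C> G)"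
          using pm assms(1) by (intro finite_epg) auto
        moreover have "card (vars (fst y)) < n" if "y \<in> epg fr (Q, \<nu>) \<C> G" for y
          using epg_vars_less[OF pm False, of "fst y" "snd y"] that w(2) by simp
        ultimately show ?thesis
          using that[OF sat_step.unsaturated[OF w(1) False]] less.prems(1) epg_partially_mapped
          by (metis Un_iff finite_Diff finite_UnI)
      qed
      \<comment> \<open>The processed element cannot return and its groundings have rank below
        \<open>n\<close>, so the inclusion is strict.\<close>
      have "{w \<in> W'. card (vars (fst w)) = n} \<subset> {w \<in> W. card (vars (fst w)) = n}"
        using W'(2) w by fastforce
      then have smaller: "card {w \<in> W'. card (vars (fst w)) = n} < card {w \<in> W. card (vars (fst w)) = n}"
        using less.prems(1) by (simp add: psubset_card_mono)
      have "\<forall>w\<in>W'. partially_mapped_bgp w \<and> card (vars (fst w)) < Suc n"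
        using W'(2) less.prems(2) less_SucI by blast
      then have "\<exists>\<Omega>'. (sat_step fr \<C> G)\<^sup>*\<^sup>* (W', \<Omega>1) ({}, \<Omega>')"
        by (rule less.hyps[OF smaller W'(1)])
      then show ?thesis
        by (elim ex_forward) (rule converse_rtranclp_into_rtranclp[where r = "sat_step fr \<C> G", OF step])
    qed
  qed
qed

lemma partially_mapped_bgp_empty: "bgp P \<Longrightarrow> partially_mapped_bgp (P, Map.empty)"
  by (simp add: mapping_def)

text \<open>Combines existence of a terminating run with uniqueness of its result.\<close>

lemma sat_eq:
  assumes "bgp P" "graph G"
  shows "sat fr P \<C> G = {\<omega>. saturates_to fr \<C> G (P, Map.empty) \<omega>}"
proof -
  let ?S = "{\<omega>. saturates_to fr \<C> G (P, Map.empty) \<omega>}"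
  have unique: "\<Omega> = ?S" if "(sat_step fr \<C> G)\<^sup>*\<^sup>* ({(P, Map.empty)}, {}) ({}, \<Omega>)" for \<Omega>
    using sat_run_invariant[OF that] by simp
  obtain \<Omega> where run: "(sat_step fr \<C> G)\<^sup>*\<^sup>* ({(P, Map.empty)}, {}) ({}, \<Omega>)"
    using sat_run_exists[OF assms(2), of "{(P, Map.empty)}" "Suc (card (vars P))" fr \<C> "{}"]
      partially_mapped_bgp_empty[OF assms(1)] by auto
  show ?thesis
    unfolding sat_def
  proof (rule the_equality)
    show "(sat_step fr \<C> G)\<^sup>*\<^sup>* ({(P, Map.empty)}, {}) ({}, ?S)"
      using run unique[OF run] by simp
  qed (rule unique)
qed

section \<open>Saturated instances and answers over extensions\<close>

lemma saturates_to_invariant: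
  assumes "saturates_to fr \<C> G (Q, \<nu>) \<omega>"
    and "partially_mapped_bgp (Q, \<nu>)" "fresh_for fr Q \<C> G" "Q = apply_bgp \<nu> P" "dom \<nu> \<subseteq> vars P"
  shows "partially_mapped_bgp (apply_bgp \<omega> P, \<omega>)" "fresh_for fr (apply_bgp \<omega> P) \<C> G"
    "dom \<omega> \<subseteq> vars P" "crucial fr \<C> G (apply_bgp \<omega> P) \<subseteq> G"
proof -
  have "partially_mapped_bgp (apply_bgp \<omega> P, \<omega>) \<and> fresh_for fr (apply_bgp \<omega> P) \<C> G \<and>
    dom \<omega> \<subseteq> vars P \<and> crucial fr \<C> G (apply_bgp \<omega> P) \<subseteq> G"
    using assms
  proof (induction "(Q, \<nu>)" \<omega> arbitrary: Q \<nu> rule: saturates_to.induct)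
    case (saturated Q \<nu>)
    then show ?case
      using epg_saturatedD[OF saturated(1)] by simp
  next
    case (unsaturated Q \<nu> Q' \<nu>' \<omega>)
    show ?case
      using unsaturated.hyps(4) epg_invariant[OF unsaturated.prems unsaturated.hyps(2)] by blast
  qed
  then show "partially_mapped_bgp (apply_bgp \<omega> P, \<omega>)" "fresh_for fr (apply_bgp \<omega> P) \<C> G"
    "dom \<omega> \<subseteq> vars P" "crucial fr \<C> G (apply_bgp \<omega> P) \<subseteq> G"
    by blast+
qed

text \<open>Follow, in each step, the grounding that agrees with the answer; the number of variables
  decreases. Only \<open>\<subseteq>\<^sub>m\<close> can be claimed, since a branch may saturate
  with variables left.\<close>

lemma answer_saturates_to:
  assumes "extension_pair G G'" "valid_wrt G G' \<C>"
    and "fresh_for fr Q \<C> G" "partially_mapped_bgp (Q, \<nu>)" "\<tau> \<in> eval_bgp Q G'"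
  shows "\<exists>\<omega>. saturates_to fr \<C> G (Q, \<nu>) \<omega> \<and> \<omega> \<subseteq>\<^sub>m \<nu> ++ \<tau>"
  using assms(3-5)
proof (induction "card (vars Q)" arbitrary: Q \<nu> \<tau> rule: less_induct)
  case less
  show ?case
  proof (cases "epg fr (Q, \<nu>) \<C> G = {(Q, \<nu>)}")
    case True
    have "dom \<nu> \<inter> dom \<tau> = {}"
      using less.prems by (simp add: eval_bgp_def)
    then have "\<nu> \<subseteq>\<^sub>m \<nu> ++ \<tau>"
      by (metis map_add_comm map_le_map_add)
    then show ?thesis
      using saturates_to.saturated[OF True] by blast
  next
    case False
    obtain Q' \<nu>' \<rho> where *: "(Q', \<nu>') \<in> epg fr (Q, \<nu>) \<C> G" "fresh_for fr Q' \<C> G"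
      "\<rho> \<in> eval_bgp Q' G'" "\<nu>' ++ \<rho> = \<nu> ++ \<tau>"
      using answer_in_epg[OF less.prems(1) assms(1,2) less.prems(3,2)] by metis
    then obtain \<omega> where "saturates_to fr \<C> G (Q', \<nu>') \<omega>" "\<omega> \<subseteq>\<^sub>m \<nu> ++ \<tau>"
      using less.hyps[OF epg_vars_less[OF less.prems(2) False *(1)] *(2) epg_partially_mapped[OF *(1)] *(3)]
      by auto
    then show ?thesis
      using saturates_to.unsaturated[OF False *(1)] by blast
  qed
qed

theorem theorem1:
  fixes P G :: "('i::infinite, 'l::infinite, 'v::infinite) rdf_triple set"
    and \<C> :: "('i, 'l, 'v) compl_stmt set"
    and fr :: "'v \<Rightarrow> 'i"
  assumes "bgp P"
    and "finite \<C>"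
    and "\<forall>C\<in>\<C>. completeness_statement C"
    and "graph G"
    and "fresh_for fr P \<C> G"
  shows "entails_compl \<C> G (Compl P) \<longleftrightarrow>
         (\<forall>\<mu>\<in>sat fr P \<C> G. prototypical fr (apply_bgp \<mu> P) \<subseteq> G)"
proof -
  have pm: "partially_mapped_bgp (P, Map.empty)"
    using assms(1) by (rule partially_mapped_bgp_empty)
  have P: "P = apply_bgp Map.empty P"
    by (simp add: apply_bgp_disjoint)
  have inv: "partially_mapped_bgp (apply_bgp \<omega> P, \<omega>)" "fresh_for fr (apply_bgp \<omega> P) \<C> G"
    "dom \<omega> \<subseteq> vars P" "crucial fr \<C> G (apply_bgp \<omega> P) \<subseteq> G" if "\<omega> \<in> sat fr P \<C> G" for \<omega>
    using saturates_to_invariant[OF _ pm assms(5) P] that sat_eq[OF assms(1,4), of fr \<C>] by auto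
  show ?thesis
  proof
    assume entails: "entails_compl \<C> G (Compl P)"
    show "\<forall>\<mu>\<in>sat fr P \<C> G. prototypical fr (apply_bgp \<mu> P) \<subseteq> G"
    proof
      fix \<omega> assume "\<omega> \<in> sat fr P \<C> G"
      note inv = inv[OF this]
      let ?Q = "apply_bgp \<omega> P"
      let ?G' = "G \<union> prototypical fr ?Q"
      \<comment> \<open>The saturated mapping, completed by freezing the variables it leaves open,
        is an answer of \<open>P\<close> over the extension.\<close>
      define \<sigma> where "\<sigma> = \<omega> ++ freeze fr ?Q"
      have m: "mapping \<omega>" "finite ?Q"
        using inv(1) by (auto simp: bgp_def)
      have "dom \<omega> \<inter> dom (freeze fr ?Q) = {}"
        using inv(1) by (simp add: dom_freeze)
      then have eq: "apply_bgp \<sigma> P = prototypical fr ?Q"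
        unfolding \<sigma>_def prototypical_def by (rule apply_bgp_map_add[OF m(1)])
      have "dom \<sigma> = vars P"
        using inv(3) vars_apply_bgp[OF m(1), of P] by (auto simp: \<sigma>_def dom_freeze)
      then have "\<sigma> \<in> eval_bgp P ?G'"
        using eq mapping_map_add[OF m(1) mapping_freeze[OF m(2)]]
        by (simp add: eval_bgp_def \<sigma>_def)
      moreover have "extension_pair G ?G'"
        using assms(4) graph_prototypical[of ?Q fr] inv(1)
        by (auto simp: extension_pair_def graph_def)
      ultimately have "\<sigma> \<in> eval_bgp P G"
        using entails frozen_extension_valid[OF assms(4) inv(2,4)]
        by (auto simp: entails_compl_def satisfies_compl_def)
      then show "prototypical fr ?Q \<subseteq> G"
        using eq by (simp add: eval_bgp_def)
    qed
  next
    assume sat: "\<forall>\<mu>\<in>sat fr P \<C> G. prototypical fr (apply_bgp \<mu> P) \<subseteq> G"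
    have "\<tau> \<in> eval_bgp P G"
      if ext: "extension_pair G G'" "valid_wrt G G' \<C>" and \<tau>: "\<tau> \<in> eval_bgp P G'" for G' \<tau>
    proof -
      obtain \<omega> where \<omega>: "\<omega> \<in> sat fr P \<C> G" "\<omega> \<subseteq>\<^sub>m \<tau>"
        using answer_saturates_to[OF ext assms(5) pm \<tau>] sat_eq[OF assms(1,4), of fr \<C>] by auto
      let ?Q = "apply_bgp \<omega> P"
      have sub: "prototypical fr ?Q \<subseteq> G"
        using sat \<omega>(1) by blast
      \<comment> \<open>As \<open>G\<close> contains no fresh IRI, the inclusion leaves no variable
        to freeze, so \<open>\<omega>\<close> binds all of \<open>P\<close> and must coincide with
        \<open>\<tau>\<close>.\<close>
      have no_vars: "vars ?Q = {}"
        using inv(2)[OF \<omega>(1)] sub by (rule vars_empty_if_prototypical_subset)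
      then have "prototypical fr ?Q = ?Q"
        by (simp add: prototypical_def apply_bgp_disjoint)
      moreover have "dom \<tau> \<subseteq> dom \<omega>"
        using no_vars vars_apply_bgp[of \<omega> P] inv(1)[OF \<omega>(1)] \<tau> by (auto simp: eval_bgp_def)
      then have "\<omega> = \<tau>"
        using \<omega>(2) map_le_antisym by (metis (no_types, lifting) map_le_def subsetD)
      ultimately show ?thesis
        using sub \<tau> by (simp add: eval_bgp_def)
    qed
    then have "eval_bgp P G' = eval_bgp P G" if "extension_pair G G'" "valid_wrt G G' \<C>" for G'
      using that eval_bgp_mono[of G G' P] by (intro subset_antisym subsetI) (auto simp: extension_pair_def)
    then show "entails_compl \<C> G (Compl P)"
      by (simp add: entails_compl_def satisfies_compl_def)
  qed
qed

end
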